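(* Let $n\ge 1$ be an integer, and let $P$ be a homogeneous multilinear polynomial with complex coefficients which has exactly $n$ monomial terms (with nonzero coefficients), has total degree at least two, and has totally non-overlapping monomial support (that is, no variable occurs in two distinct monomial terms of $P$). Then the Chow rank of $P$ is exactly $n$.
   Context: All polynomials are over $\mathbb{C}$. For a polynomial $P\in\mathbb{C}[x_0,\dots,x_{N-1}]$ of degree $d\ge 1$, the Chow rank of $P$ is the smallest number $\rho$ of summands in an expression of the form $$P(\boldsymbol{x})=\sum_{u=0}^{\rho-1}\ \prod_{v=0}^{d-1} \ell_{u,v}(x_0,\dots,x_{N-1}),\qquad \ell_{u,v}=H_{u,v,N}+\sum_{w=0}^{N-1}H_{u,v,w}\,x_w ,$$ with $H\in\mathbb{C}^{\rho\times d\times (N+1)}$; the $\ell_{u,v}$ are thus arbitrary, possibly non-homogeneous, linear (affine) forms. A polynomial is multilinear if each variable has degree at most one in each monomial. After relabelling of variables, a homogeneous multilinear polynomial of degree $m$ with $n$ terms and totally non-overlapping monomial support has the form $\sum_{i=0}^{n-1}\alpha_i\prod_{j=0}^{m-1}x_{mi+j}$ with all $\alpha_i\in\mathbb{C}\setminus\{0\}$. *)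

theory Defs
  imports Complex_Main "HOL-Library.Poly_Mapping" "HOL-Library.Extended_Nat"
begin

text \<open>
  The polynomial ring over the complex numbers in the variables indexed by the natural numbers
  is the monoid algebra of the monoid of finitely supported exponent vectors; multiplication of
  \<open>\<Rightarrow>\<^sub>0\<close> is convolution. The ring in \<open>N\<close> variables is the set of polynomials
  in which only variables with index below \<open>N\<close> occur.
\<close>

type_synonym monomial = "nat \<Rightarrow>\<^sub>0 nat"
type_synonym cpoly = "monomial \<Rightarrow>\<^sub>0 complex"

definition Const :: "complex \<Rightarrow> cpoly" where
  "Const c = Poly_Mapping.single 0 c"

definition Var :: "nat \<Rightarrow> cpoly" where
  "Var i = Poly_Mapping.single (Poly_Mapping.single i 1) 1"

definition polys_in :: "nat \<Rightarrow> cpoly set" where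
  "polys_in N = {P. \<forall>m\<in>Poly_Mapping.keys P. Poly_Mapping.keys m \<subseteq> {..<N}}"

definition monomial_degree :: "monomial \<Rightarrow> nat" where
  "monomial_degree m = (\<Sum>i\<in>Poly_Mapping.keys m. Poly_Mapping.lookup m i)"

text \<open>The zero polynomial gets total degree 0.\<close>

definition total_degree :: "cpoly \<Rightarrow> nat" where
  "total_degree P = Max (insert 0 (monomial_degree ` Poly_Mapping.keys P))"

definition homogeneous :: "cpoly \<Rightarrow> bool" where
  "homogeneous P \<longleftrightarrow> (\<exists>d. \<forall>m\<in>Poly_Mapping.keys P. monomial_degree m = d)"

definition multilinear :: "cpoly \<Rightarrow> bool" where
  "multilinear P \<longleftrightarrow> (\<forall>m\<in>Poly_Mapping.keys P. \<forall>i. Poly_Mapping.lookup m i \<le> 1)"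

definition nonoverlapping_support :: "cpoly \<Rightarrow> bool" where
  "nonoverlapping_support P \<longleftrightarrow>
     (\<forall>m\<in>Poly_Mapping.keys P. \<forall>m'\<in>Poly_Mapping.keys P.
        m \<noteq> m' \<longrightarrow> Poly_Mapping.keys m \<inter> Poly_Mapping.keys m' = {})"

text \<open>The coefficient at index \<open>N\<close> is the constant term of the affine form.\<close>

definition affine_form :: "nat \<Rightarrow> (nat \<Rightarrow> complex) \<Rightarrow> cpoly" where
  "affine_form N h = Const (h N) + (\<Sum>w<N. Const (h w) * Var w)"

definition chow_decomposition ::
    "nat \<Rightarrow> cpoly \<Rightarrow> nat \<Rightarrow> (nat \<Rightarrow> nat \<Rightarrow> nat \<Rightarrow> complex) \<Rightarrow> bool" where
  "chow_decomposition N P \<rho> H \<longleftrightarrow>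
     P = (\<Sum>u<\<rho>. \<Prod>v<total_degree P. affine_form N (H u v))"

text \<open>
  The notion is intended for \<open>P \<in> polys_in N\<close> of total degree at least 1. Taking the infimum
  in \<^typ>\<open>enat\<close> gives the least number of summands if there is a decomposition,
  and \<open>\<infinity>\<close> otherwise.
\<close>

definition chow_rank :: "nat \<Rightarrow> cpoly \<Rightarrow> enat" where
  "chow_rank N P = Inf {enat \<rho> |\<rho>. \<exists>H. chow_decomposition N P \<rho> H}"

end

theory Submission
  imports Defs
begin

text \<open>
  A product of \<open>d\<close> affine forms only involves \<open>d\<close> linear functionals. If fewer than \<open>n\<close> products
  sum to \<open>P\<close>, there are fewer functionals than the \<open>n d\<close> variables of \<open>P\<close>, so some nonzero vector
  \<open>a\<close> in the span of those variables is annihilated by all of them, and \<open>P\<close> is invariant under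
  translation along \<open>a\<close>. Pick a variable \<open>k\<close> with \<open>a k \<noteq> 0\<close>, in the monomial \<open>M\<close>, and start at the
  point whose coordinates are 1 on the other variables of \<open>M\<close> and 0 elsewhere: along the line
  with direction \<open>a\<close>, the monomial \<open>M\<close> vanishes to first order and the other ones to order
  \<open>d \<ge> 2\<close>, so \<open>P\<close> is not constant.
\<close>

section \<open>Evaluation at a point as a ring homomorphism\<close>

definition eval_monomial :: "(nat \<Rightarrow> complex) \<Rightarrow> monomial \<Rightarrow> complex" where
  "eval_monomial x m = (\<Prod>i\<in>Poly_Mapping.keys m. x i ^ Poly_Mapping.lookup m i)"

definition eval_poly :: "(nat \<Rightarrow> complex) \<Rightarrow> cpoly \<Rightarrow> complex" where
  "eval_poly x P = (\<Sum>m\<in>Poly_Mapping.keys P. Poly_Mapping.lookup P m * eval_monomial x m)"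

text \<open>Variables outside the support contribute \<open>x i ^ 0 = 1\<close>. This lets two
  monomials be multiplied over a common index set.\<close>

lemma eval_monomial_superset:
  assumes "finite A" "Poly_Mapping.keys m \<subseteq> A"
  shows "eval_monomial x m = (\<Prod>i\<in>A. x i ^ Poly_Mapping.lookup m i)"
  unfolding eval_monomial_def
  by (rule prod.mono_neutral_left) (use assms in \<open>auto simp: in_keys_iff\<close>)

lemma eval_monomial_zero [simp]: "eval_monomial x 0 = 1"
  by (simp add: eval_monomial_def)

lemma eval_monomial_single [simp]: "eval_monomial x (Poly_Mapping.single i 1) = x i"
  by (simp add: eval_monomial_def)

lemma eval_monomial_add: "eval_monomial x (m + m') = eval_monomial x m * eval_monomial x m'"
proof -
  let ?A = "Poly_Mapping.keys m \<union> Poly_Mapping.keys m'"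
  have "eval_monomial x (m + m') = (\<Prod>i\<in>?A. x i ^ Poly_Mapping.lookup (m + m') i)"
    using keys_add[of m m'] by (intro eval_monomial_superset) auto
  also have "\<dots> = (\<Prod>i\<in>?A. x i ^ Poly_Mapping.lookup m i) * (\<Prod>i\<in>?A. x i ^ Poly_Mapping.lookup m' i)"
    by (simp add: lookup_add power_add prod.distrib)
  also have "\<dots> = eval_monomial x m * eval_monomial x m'"
    by (simp add: eval_monomial_superset[of ?A])
  finally show ?thesis .
qed

lemma eval_poly_zero [simp]: "eval_poly x 0 = 0"
  by (simp add: eval_poly_def)

lemma eval_poly_single: "eval_poly x (Poly_Mapping.single m c) = c * eval_monomial x m"
  by (simp add: eval_poly_def)

lemma eval_poly_add: "eval_poly x (P + Q) = eval_poly x P + eval_poly x Q"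
  unfolding eval_poly_def by (rule setsum_keys_plus_distrib) (auto simp: algebra_simps)

lemma eval_poly_sum: "eval_poly x (\<Sum>i\<in>A. f i) = (\<Sum>i\<in>A. eval_poly x (f i))"
  by (induction A rule: infinite_finite_induct) (auto simp: eval_poly_add)

text \<open>Left generic in its types: it splits polynomials into terms and, later, exponent vectors
  into multiples of unit vectors.\<close>

lemma poly_mapping_sum_single:
  "(\<Sum>m\<in>Poly_Mapping.keys P. Poly_Mapping.single m (Poly_Mapping.lookup P m)) = P"
proof (rule poly_mapping_eqI)
  fix k
  show "Poly_Mapping.lookup (\<Sum>m\<in>Poly_Mapping.keys P. Poly_Mapping.single m (Poly_Mapping.lookup P m)) k
      = Poly_Mapping.lookup P k"
    by (cases "k \<in> Poly_Mapping.keys P")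
      (auto simp: lookup_sum lookup_single when_def in_keys_iff)
qed

text \<open>By distributivity it is enough to multiply single terms, where
  \<open>eval_monomial_add\<close> applies.\<close>

lemma eval_poly_mult: "eval_poly x (P * Q) = eval_poly x P * eval_poly x Q"
proof -
  let ?s = "\<lambda>P m. Poly_Mapping.single m (Poly_Mapping.lookup P m)"
  have "P * Q = (\<Sum>m\<in>Poly_Mapping.keys P. ?s P m) * (\<Sum>m\<in>Poly_Mapping.keys Q. ?s Q m)"
    by (simp only: poly_mapping_sum_single)
  also have "eval_poly x \<dots> = (\<Sum>m\<in>Poly_Mapping.keys P. \<Sum>m'\<in>Poly_Mapping.keys Q.
      (Poly_Mapping.lookup P m * eval_monomial x m) * (Poly_Mapping.lookup Q m' * eval_monomial x m'))"
    by (simp add: sum_product eval_poly_sum mult_single eval_poly_single eval_monomial_add mult_ac)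
  also have "\<dots> = eval_poly x P * eval_poly x Q"
    by (simp add: eval_poly_def sum_product)
  finally show ?thesis .
qed

lemma eval_poly_one [simp]: "eval_poly x 1 = 1"
  using eval_poly_single[of x 0 1] by simp

lemma eval_poly_prod: "eval_poly x (\<Prod>i\<in>A. f i) = (\<Prod>i\<in>A. eval_poly x (f i))"
  by (induction A rule: infinite_finite_induct) (auto simp: eval_poly_mult)

lemma eval_poly_affine_form: "eval_poly x (affine_form N h) = h N + (\<Sum>w<N. h w * x w)"
proof -
  have "eval_poly x (Const c) = c" for c
    by (simp add: Const_def eval_poly_single)
  moreover have "eval_poly x (Var i) = x i" for i
    by (simp add: Var_def eval_poly_single del: One_nat_def)
  ultimately show ?thesis
    by (simp add: affine_form_def eval_poly_add eval_poly_sum eval_poly_mult)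
qed

section \<open>Underdetermined homogeneous linear systems\<close>

text \<open>Gaussian elimination, by induction on the set of equations. An equation whose
  coefficients all vanish on \<open>J\<close> is dropped; any other one is used to eliminate an
  unknown, so that both counts fall by one.\<close>

lemma homogeneous_linear_system_nontrivial_solution:
  fixes c :: "'i \<Rightarrow> 'j \<Rightarrow> 'a::field"
  assumes "finite I" "finite J" "card I < card J"
  shows "\<exists>a. (\<exists>j\<in>J. a j \<noteq> 0) \<and> (\<forall>j. j \<notin> J \<longrightarrow> a j = 0) \<and> (\<forall>i\<in>I. (\<Sum>j\<in>J. c i j * a j) = 0)"
  using assms
proof (induction I arbitrary: J c rule: finite_induct)
  case empty
  then obtain j where "j \<in> J" by fastforce
  then show ?case by (intro exI[of _ "\<lambda>i. if i = j then 1 else 0"]) auto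
next
  case (insert i0 I)
  show ?case
  proof (cases "\<forall>j\<in>J. c i0 j = 0")
    case True
    with insert.IH[of J c] insert.prems insert.hyps show ?thesis by auto
  next
    case False
    then obtain j0 where j0: "j0 \<in> J" "c i0 j0 \<noteq> 0" by auto
    let ?J = "J - {j0}"
    \<comment> \<open>Row \<open>i\<close> minus the multiple of row \<open>i0\<close> that cancels
      its entry at \<open>j0\<close>.\<close>
    define c' where "c' i j = c i j - c i j0 * c i0 j / c i0 j0" for i j
    have "card I < card ?J" using insert j0 by simp
    with insert.IH[of ?J c'] insert.prems obtain a where
      a: "\<exists>j\<in>?J. a j \<noteq> 0" "\<forall>j. j \<notin> ?J \<longrightarrow> a j = 0" "\<forall>i\<in>I. (\<Sum>j\<in>?J. c' i j * a j) = 0"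
      by auto
    define S where "S = (\<Sum>j\<in>?J. c i0 j * a j)"
    \<comment> \<open>The value at \<open>j0\<close> is forced by equation \<open>i0\<close>; all
      other entries stay those of \<open>a\<close>.\<close>
    define b where "b = a(j0 := - S / c i0 j0)"
    have split: "(\<Sum>j\<in>J. c i j * b j) = (\<Sum>j\<in>?J. c i j * a j) - c i j0 * S / c i0 j0" for i
      using j0 insert.prems by (simp add: sum.remove[of J j0] b_def)
    have "(\<Sum>j\<in>J. c i j * b j) = 0" if "i \<in> I" for i
    proof -
      have "0 = (\<Sum>j\<in>?J. c' i j * a j)" using a that by simp
      also have "\<dots> = (\<Sum>j\<in>?J. c i j * a j) - (\<Sum>j\<in>?J. (c i j0 / c i0 j0) * (c i0 j * a j))"
        by (simp add: c'_def left_diff_distrib sum_subtractf mult.assoc)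
      also have "\<dots> = (\<Sum>j\<in>J. c i j * b j)"
        by (simp add: split S_def sum_distrib_left sum_divide_distrib)
      finally show ?thesis by simp
    qed
    moreover have "(\<Sum>j\<in>J. c i0 j * b j) = 0" using j0 by (simp add: split S_def)
    moreover have "\<exists>j\<in>J. b j \<noteq> 0" "\<forall>j. j \<notin> J \<longrightarrow> b j = 0" using a j0 by (auto simp: b_def)
    ultimately show ?thesis by blast
  qed
qed

section \<open>Monomials of homogeneous multilinear polynomials\<close>

text \<open>Since \<open>m\<close> is a key, the set of degrees is a singleton, and the default 0
  inside \<open>total_degree\<close> does not affect the maximum.\<close>

lemma homogeneous_monomial_degree:
  assumes "homogeneous P" "m \<in> Poly_Mapping.keys P"
  shows "monomial_degree m = total_degree P"
proof -
  from assms obtain d where d: "\<forall>m\<in>Poly_Mapping.keys P. monomial_degree m = d"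
    by (auto simp: homogeneous_def)
  then have "monomial_degree ` Poly_Mapping.keys P = {d}" using assms by auto
  then show ?thesis using d assms by (simp add: total_degree_def)
qed

lemma multilinear_lookup:
  assumes "multilinear P" "m \<in> Poly_Mapping.keys P" "i \<in> Poly_Mapping.keys m"
  shows "Poly_Mapping.lookup m i = 1"
proof -
  have "Poly_Mapping.lookup m i \<le> 1" using assms(1,2) by (auto simp: multilinear_def)
  moreover have "Poly_Mapping.lookup m i \<noteq> 0" using assms(3) by (simp add: in_keys_iff)
  ultimately show ?thesis by simp
qed

text \<open>All exponents are 1, so the degree of a monomial counts its variables.\<close>

lemma multilinear_card_keys:
  assumes "multilinear P" "homogeneous P" "m \<in> Poly_Mapping.keys P"
  shows "card (Poly_Mapping.keys m) = total_degree P"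
  using homogeneous_monomial_degree[OF assms(2,3)] multilinear_lookup[OF assms(1,3)]
  by (simp add: monomial_degree_def)

lemma prod_Var:
  assumes "finite A"
  shows "(\<Prod>i\<in>A. Var i) = Poly_Mapping.single (\<Sum>i\<in>A. Poly_Mapping.single i 1) 1"
  using assms by (induction A) (auto simp: Var_def mult_single)

lemma multilinear_single_conv_prod_Var:
  assumes "multilinear P" "m \<in> Poly_Mapping.keys P"
  shows "Poly_Mapping.single m 1 = (\<Prod>i\<in>Poly_Mapping.keys m. Var i)"
proof -
  have "m = (\<Sum>i\<in>Poly_Mapping.keys m. Poly_Mapping.single i (Poly_Mapping.lookup m i))"
    by (simp only: poly_mapping_sum_single)
  also have "\<dots> = (\<Sum>i\<in>Poly_Mapping.keys m. Poly_Mapping.single i 1)"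
    by (intro sum.cong) (use multilinear_lookup[OF assms] in auto)
  finally show ?thesis by (simp add: prod_Var)
qed

section \<open>Upper bound: one product per monomial\<close>

lemma affine_form_scaled_Var:
  assumes "i < N"
  shows "affine_form N (\<lambda>w. if w = i then c else 0) = Const c * Var i"
proof -
  have "(\<Sum>w<N. Const (if w = i then c else 0) * Var w) = (\<Sum>w<N. if w = i then Const c * Var w else 0)"
    by (intro sum.cong) (auto simp: Const_def)
  then show ?thesis using assms by (simp add: affine_form_def Const_def)
qed

lemma chow_decomposition_by_monomials:
  assumes "P \<in> polys_in N" "homogeneous P" "multilinear P" "total_degree P \<ge> 1"
  shows "\<exists>H. chow_decomposition N P (card (Poly_Mapping.keys P)) H"
proof -
  let ?d = "total_degree P"
  obtain e where e: "bij_betw e {..<card (Poly_Mapping.keys P)} (Poly_Mapping.keys P)"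
    using ex_bij_betw_nat_finite[of "Poly_Mapping.keys P"] by (auto simp: atLeast0LessThan)
  have "\<exists>f. bij_betw f {..<?d} (Poly_Mapping.keys m)" if "m \<in> Poly_Mapping.keys P" for m
    using ex_bij_betw_nat_finite[of "Poly_Mapping.keys m"] multilinear_card_keys[OF assms(3,2) that]
    by (auto simp: atLeast0LessThan)
  then obtain f where f: "\<And>m. m \<in> Poly_Mapping.keys P \<Longrightarrow> bij_betw (f m) {..<?d} (Poly_Mapping.keys m)"
    by metis
  \<comment> \<open>The whole coefficient of a term goes into its factor number 0, which exists
    because the degree is at least 1.\<close>
  define c where "c m v = (if v = 0 then Poly_Mapping.lookup P m else 1)" for m and v :: nat
  \<comment> \<open>\<open>e\<close> enumerates the monomials and \<open>f (e u)\<close> the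
    variables of the \<open>u\<close>-th one. As these variables lie below \<open>N\<close>, the
    entry at \<open>w = N\<close>, the constant term, is 0.\<close>
  define H where "H u v w = (if w = f (e u) v then c (e u) v else 0)" for u v w
  have summand: "(\<Prod>v<?d. Const (c m v) * Var (f m v)) = Poly_Mapping.single m (Poly_Mapping.lookup P m)"
    if m: "m \<in> Poly_Mapping.keys P" for m
  proof -
    have "(\<Prod>v<?d. Const (c m v)) = (\<Prod>v<?d. if v = 0 then Const (Poly_Mapping.lookup P m) else 1)"
      by (intro prod.cong) (auto simp: c_def Const_def)
    also have "\<dots> = Const (Poly_Mapping.lookup P m)" using assms(4) by simp
    finally have "(\<Prod>v<?d. Const (c m v)) = Const (Poly_Mapping.lookup P m)" .
    moreover have "(\<Prod>v<?d. Var (f m v)) = Poly_Mapping.single m 1"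
      using prod.reindex_bij_betw[OF f[OF m], of Var] multilinear_single_conv_prod_Var[OF assms(3) m]
      by simp
    ultimately show ?thesis by (simp add: prod.distrib Const_def mult_single)
  qed
  have aff: "affine_form N (H u v) = Const (c (e u) v) * Var (f (e u) v)"
    if "u < card (Poly_Mapping.keys P)" "v < ?d" for u v
  proof -
    have m: "e u \<in> Poly_Mapping.keys P" using e that by (auto dest: bij_betwE)
    then have "f (e u) v \<in> Poly_Mapping.keys (e u)" using f that by (auto dest: bij_betwE)
    then have "f (e u) v < N" using assms(1) m by (auto simp: polys_in_def)
    then show ?thesis unfolding H_def by (rule affine_form_scaled_Var)
  qed
  have "(\<Sum>u<card (Poly_Mapping.keys P). \<Prod>v<?d. affine_form N (H u v))
      = (\<Sum>u<card (Poly_Mapping.keys P). Poly_Mapping.single (e u) (Poly_Mapping.lookup P (e u)))"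
  proof (intro sum.cong refl)
    fix u assume u: "u \<in> {..<card (Poly_Mapping.keys P)}"
    then have "e u \<in> Poly_Mapping.keys P" using e by (auto dest: bij_betwE)
    from summand[OF this] u aff
    show "(\<Prod>v<?d. affine_form N (H u v)) = Poly_Mapping.single (e u) (Poly_Mapping.lookup P (e u))"
      by simp
  qed
  also have "\<dots> = P"
    using sum.reindex_bij_betw[OF e, of "\<lambda>m. Poly_Mapping.single m (Poly_Mapping.lookup P m)"]
    by (simp add: poly_mapping_sum_single)
  finally show ?thesis unfolding chow_decomposition_def by metis
qed

section \<open>Lower bound: translation invariance\<close>

lemma multilinear_eval_poly:
  assumes "multilinear P"
  shows "eval_poly x P = (\<Sum>m\<in>Poly_Mapping.keys P. Poly_Mapping.lookup P m * (\<Prod>i\<in>Poly_Mapping.keys m. x i))"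
  unfolding eval_poly_def eval_monomial_def
  by (intro sum.cong arg_cong2[of _ _ _ _ "(*)"] prod.cong refl)
    (use multilinear_lookup[OF assms] in auto)

text \<open>Moving along \<open>a\<close> changes no affine form of the decomposition, since each
  linear part annihilates \<open>a\<close>; evaluation carries this over to the sum of
  products.\<close>

lemma chow_decomposition_eval_translate:
  assumes "chow_decomposition N P \<rho> H"
    and "\<And>u v. u < \<rho> \<Longrightarrow> v < total_degree P \<Longrightarrow> (\<Sum>w<N. H u v w * a w) = 0"
  shows "eval_poly (\<lambda>w. x w + t * a w) P = eval_poly x P"
proof -
  have "eval_poly (\<lambda>w. x w + t * a w) (affine_form N (H u v)) = eval_poly x (affine_form N (H u v))"
    if "u < \<rho>" "v < total_degree P" for u v
  proof -
    have "(\<Sum>w<N. H u v w * (x w + t * a w)) = (\<Sum>w<N. H u v w * x w) + t * (\<Sum>w<N. H u v w * a w)"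
      by (simp add: algebra_simps sum.distrib sum_distrib_left)
    then show ?thesis using assms(2)[OF that] by (simp add: eval_poly_affine_form)
  qed
  then have "(\<Sum>u<\<rho>. \<Prod>v<total_degree P. eval_poly (\<lambda>w. x w + t * a w) (affine_form N (H u v)))
      = (\<Sum>u<\<rho>. \<Prod>v<total_degree P. eval_poly x (affine_form N (H u v)))"
    by (intro sum.cong prod.cong) auto
  moreover have "eval_poly y P = (\<Sum>u<\<rho>. \<Prod>v<total_degree P. eval_poly y (affine_form N (H u v)))" for y
    using arg_cong[OF assms(1)[unfolded chow_decomposition_def], of "eval_poly y"]
    by (simp add: eval_poly_sum eval_poly_prod)
  ultimately show ?thesis by simp
qed

lemma nonoverlapping_not_translation_invariant:
  assumes "homogeneous P" "multilinear P" "nonoverlapping_support P" "total_degree P \<ge> 2"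
    and "M \<in> Poly_Mapping.keys P" "k \<in> Poly_Mapping.keys M" "a k \<noteq> 0"
  shows "\<exists>x t. eval_poly (\<lambda>w. x w + t * a w) P \<noteq> eval_poly x P"
proof (rule ccontr)
  assume "\<not> ?thesis"
  then have inv: "eval_poly (\<lambda>w. x w + t * a w) P = eval_poly x P" for x t by blast
  define d where "d = total_degree P"
  define x :: "nat \<Rightarrow> complex" where "x w = (if w \<in> Poly_Mapping.keys M - {k} then 1 else 0)" for w
  define C where "C = (\<Sum>m\<in>Poly_Mapping.keys P - {M}. Poly_Mapping.lookup P m * (\<Prod>i\<in>Poly_Mapping.keys m. a i))"
  \<comment> \<open>The value of \<open>P\<close> at \<open>x + t a\<close> divided by
    \<open>t\<close>: the first summand comes from \<open>M\<close>, whose factor at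
    \<open>k\<close> is \<open>t * a k\<close>, and \<open>C\<close> collects the other
    monomials.\<close>
  define g where "g t = Poly_Mapping.lookup P M * (a k * (\<Prod>i\<in>Poly_Mapping.keys M - {k}. 1 + t * a i))
      + t ^ (d - 1) * C" for t
  have d: "d \<ge> 2" using assms by (simp add: d_def)
  then have td: "t ^ d = t * t ^ (d - 1)" for t :: complex by (cases d) auto
  have other: "(\<Prod>i\<in>Poly_Mapping.keys m. x i + t * a i) = t ^ d * (\<Prod>i\<in>Poly_Mapping.keys m. a i)"
    if "m \<in> Poly_Mapping.keys P - {M}" for m t
  proof -
    have "Poly_Mapping.keys m \<inter> Poly_Mapping.keys M = {}"
      using that assms by (auto simp: nonoverlapping_support_def)
    then have "(\<Prod>i\<in>Poly_Mapping.keys m. x i + t * a i) = (\<Prod>i\<in>Poly_Mapping.keys m. t * a i)"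
      by (intro prod.cong) (auto simp: x_def)
    then show ?thesis using multilinear_card_keys[OF assms(2,1), of m] that
      by (simp add: prod.distrib d_def)
  qed
  have main: "(\<Prod>i\<in>Poly_Mapping.keys M. x i + t * a i)
      = t * a k * (\<Prod>i\<in>Poly_Mapping.keys M - {k}. 1 + t * a i)" for t
  proof -
    have "(\<Prod>i\<in>Poly_Mapping.keys M - {k}. x i + t * a i) = (\<Prod>i\<in>Poly_Mapping.keys M - {k}. 1 + t * a i)"
      by (intro prod.cong) (auto simp: x_def)
    then show ?thesis using assms(6) by (simp add: prod.remove[of _ k] x_def)
  qed
  have q: "eval_poly (\<lambda>w. x w + t * a w) P = t * g t" for t
  proof -
    have "eval_poly (\<lambda>w. x w + t * a w) P
        = Poly_Mapping.lookup P M * (t * a k * (\<Prod>i\<in>Poly_Mapping.keys M - {k}. 1 + t * a i))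
        + (\<Sum>m\<in>Poly_Mapping.keys P - {M}. Poly_Mapping.lookup P m * (t ^ d * (\<Prod>i\<in>Poly_Mapping.keys m. a i)))"
      using assms(5) by (simp add: multilinear_eval_poly[OF assms(2)] sum.remove[of _ M] main other)
    then show ?thesis
      by (simp add: g_def C_def td sum_distrib_left algebra_simps)
  qed
  \<comment> \<open>Along the line \<open>P\<close> keeps its value at \<open>t = 0\<close>, which
    is 0, so \<open>t * g t = 0\<close>.\<close>
  have "g t = 0" if "t \<noteq> 0" for t
    using q[of t] q[of 0] inv[of x t] inv[of x 0] that by simp
  \<comment> \<open>Division by \<open>t\<close> says nothing at \<open>t = 0\<close> itself;
    continuity of \<open>g\<close> supplies that value.\<close>
  then have "(g \<longlongrightarrow> 0) (at 0)"
    by (intro tendsto_eventually) (auto simp: eventually_at_filter)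
  moreover have "(g \<longlongrightarrow> g 0) (at 0)"
    unfolding g_def by (intro isContD[of 0] continuous_intros)
  ultimately have "g 0 = 0" using tendsto_unique[OF at_neq_bot] by blast
  \<comment> \<open>At 0 the product over the other variables of \<open>M\<close> is 1 and
    \<open>0 ^ (d - 1) = 0\<close> because \<open>d\<close> is at least 2, so \<open>g 0\<close> is
    the coefficient of \<open>M\<close> times \<open>a k\<close>.\<close>
  then show False using d assms(5,7) by (simp add: g_def in_keys_iff power_0_left)
qed

lemma chow_decomposition_lower_bound:
  assumes "P \<in> polys_in N" "homogeneous P" "multilinear P" "nonoverlapping_support P"
    and "total_degree P \<ge> 2" "chow_decomposition N P \<rho> H"
  shows "card (Poly_Mapping.keys P) \<le> \<rho>"
proof (rule ccontr)
  assume less: "\<not> card (Poly_Mapping.keys P) \<le> \<rho>"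
  let ?d = "total_degree P"
  define K where "K = (\<Union>m\<in>Poly_Mapping.keys P. Poly_Mapping.keys m)"
  \<comment> \<open>Non-overlapping support makes this union disjoint, so \<open>P\<close> has
    exactly \<open>?d\<close> variables per term.\<close>
  have "card K = (\<Sum>m\<in>Poly_Mapping.keys P. card (Poly_Mapping.keys m))"
    unfolding K_def using assms(4) by (intro card_UN_disjoint) (auto simp: nonoverlapping_support_def)
  also have "\<dots> = card (Poly_Mapping.keys P) * ?d"
    using multilinear_card_keys[OF assms(3,2)] by simp
  finally have "card ({..<\<rho>} \<times> {..<?d}) < card K" using less assms(5) by simp
  moreover have "finite K" by (simp add: K_def)
  \<comment> \<open>One equation per affine form. The unknowns are restricted to \<open>K\<close>,
    so that a nonzero entry of \<open>a\<close> sits at a variable occurring in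
    \<open>P\<close>.\<close>
  ultimately obtain a where a: "\<exists>j\<in>K. a j \<noteq> 0" "\<forall>j. j \<notin> K \<longrightarrow> a j = 0"
    "\<forall>i\<in>{..<\<rho>} \<times> {..<?d}. (\<Sum>w\<in>K. H (fst i) (snd i) w * a w) = 0"
    using homogeneous_linear_system_nontrivial_solution
      [of "{..<\<rho>} \<times> {..<?d}" K "\<lambda>i. H (fst i) (snd i)"] by auto
  have "(\<Sum>w<N. H u v w * a w) = 0" if "u < \<rho>" "v < ?d" for u v
  proof -
    have "K \<subseteq> {..<N}" using assms(1) by (auto simp: K_def polys_in_def)
    then have "(\<Sum>w<N. H u v w * a w) = (\<Sum>w\<in>K. H u v w * a w)"
      using a(2) by (intro sum.mono_neutral_right) auto
    then show ?thesis using a(3) that by auto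
  qed
  then have "eval_poly (\<lambda>w. x w + t * a w) P = eval_poly x P" for x t
    by (intro chow_decomposition_eval_translate[OF assms(6)])
  moreover from a(1) obtain M k where "M \<in> Poly_Mapping.keys P" "k \<in> Poly_Mapping.keys M" "a k \<noteq> 0"
    by (auto simp: K_def)
  ultimately show False
    using nonoverlapping_not_translation_invariant[OF assms(2-5)] by blast
qed

theorem lemma3p8:
  fixes n N :: nat and P :: cpoly
  assumes "n \<ge> 1"
    and "P \<in> polys_in N"
    and "homogeneous P"
    and "multilinear P"
    and "card (Poly_Mapping.keys P) = n"
    and "total_degree P \<ge> 2"
    and "nonoverlapping_support P"
  shows "chow_rank N P = enat n"
proof (rule antisym)
  show "chow_rank N P \<le> enat n"
    using chow_decomposition_by_monomials[OF assms(2-4)] assms(5,6)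
    unfolding chow_rank_def by (intro Inf_lower) auto
  show "enat n \<le> chow_rank N P"
    using chow_decomposition_lower_bound[OF assms(2-4,7,6)] assms(5)
    unfolding chow_rank_def by (intro Inf_greatest) auto
qed

end
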